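(* Let $\sigma=\{R_1,\dots,R_n\}$ be a finite signature, $R_i$ of arity $k_i$, and let $\sigma_{\mathrm{CSP}}=\{R_{1,0},R_{1,1},\dots,R_{n,0},R_{n,1}\}$ where $R_{i,0},R_{i,1}$ both have arity $k_i$. Then the family $\mathrm{MP}^\sigma_\varnothing$ and the family $\mathrm{CSP}^{\sigma_{\mathrm{CSP}}}$ are polynomial-time equivalent.
   Context: Given a poset $(P,\preceq)$ and a signature $\sigma$, a $(P,\sigma)$-structure $\mathbf G$ consists of a finite domain $G$ and, for each $R\in\sigma$ of arity $k$, a map $R^{\mathbf G}\colon G^k\to P$. A homomorphism $h\colon\mathbf G\to\mathbf H$ is a map $h\colon G\to H$ with $R^{\mathbf G}(\mathbf t)\preceq R^{\mathbf H}(h(\mathbf t))$ for all $R\in\sigma$ of arity $k$ and all $\mathbf t\in G^k$ ($h$ applied coordinatewise). Let $P_\varnothing=\{\varnothing,0,1,\star\}$ ordered by $\varnothing\preceq 0\preceq\star$, $\varnothing\preceq1\preceq\star$ ($0,1$ incomparable); $(P_\varnothing,\sigma)$-structures are called $\varnothing$-structures. Let $P_{\mathrm{CSP}}=\{0,1\}$ with $0\preceq1$; $(P_{\mathrm{CSP}},\sigma)$-structures are ordinary relational $\sigma$-structures (a tuple is in the relation iff its value is $1$) with ordinary homomorphisms. For a $\varnothing$-structure $\mathbf H$, $\mathrm{MP}^\sigma_\varnothing(\mathbf H)$ is the decision problem: given a $\varnothing$-structure $\mathbf G$, is there a homomorphism $\mathbf G\to\mathbf H$? $\mathrm{MP}^\sigma_\varnothing$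 is the family of all these problems. For a relational $\sigma$-structure $\mathbf H$, $\mathrm{CSP}^\sigma(\mathbf H)$ asks, given a relational $\sigma$-structure $\mathbf G$, whether $\mathbf G\to\mathbf H$; $\mathrm{CSP}^\sigma$ is the family of these problems. (The intended correspondence: a $\varnothing$-structure $\mathbf A$ corresponds to the relational $\sigma_{\mathrm{CSP}}$-structure on the same domain with $R_{i,j}(\mathbf t)=1$ iff $j\preceq R_i^{\mathbf A}(\mathbf t)$ for $j\in\{0,1\}$.) Two decision problems are polynomial-time equivalent if each polynomial-time reduces to the other; two families $\mathcal C,\mathcal C'$ of decision problems are polynomial-time equivalent if for every problem in $\mathcal C$ one can find in polynomial time a problem in $\mathcal C'$ polynomial-time equivalent to it, and vice versa. *)

theory Defs
  imports Main "HOL-Computational_Algebra.Polynomial"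
begin

section \<open>Structures with values in a poset\<close>

text \<open>A signature lists its relation symbols together with their arities; the list order is used
  only by the encoding below. The poset is given by a type of class \<^class>\<open>order\<close>.\<close>

type_synonym 'r signature = "('r \<times> nat) list"

definition is_signature :: "'r signature \<Rightarrow> bool" where
  "is_signature \<sigma> \<longleftrightarrow> distinct (map fst \<sigma>)"

text \<open>Tuples are lists. The values of \<open>interp G R\<close> outside \<open>(domain G)\<^sup>k\<close>, \<open>k\<close> the arity of \<open>R\<close>,
  are junk: no definition below depends on them.\<close>

record ('a, 'r, 'p) struct =
  "domain" :: "'a set"
  interp :: "'r \<Rightarrow> 'a list \<Rightarrow> 'p"

definition is_struct :: "('a, 'r, 'p) struct \<Rightarrow> bool" where
  "is_struct G \<longleftrightarrow> finite (domain G)"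

definition is_hom :: "'r signature \<Rightarrow> ('a \<Rightarrow> 'b) \<Rightarrow>
    ('a, 'r, 'p::order) struct \<Rightarrow> ('b, 'r, 'p) struct \<Rightarrow> bool" where
  "is_hom \<sigma> h G H \<longleftrightarrow>
     h ` domain G \<subseteq> domain H \<and>
     (\<forall>(R, k) \<in> set \<sigma>. \<forall>t. length t = k \<and> set t \<subseteq> domain G \<longrightarrow>
        interp G R t \<le> interp H R (map h t))"

definition hom_exists :: "'r signature \<Rightarrow>
    ('a, 'r, 'p::order) struct \<Rightarrow> ('b, 'r, 'p) struct \<Rightarrow> bool" where
  "hom_exists \<sigma> G H \<longleftrightarrow> (\<exists>h. is_hom \<sigma> h G H)"

text \<open>The poset \<open>P\<^sub>\<emptyset>\<close>. The poset \<open>P\<^sub>C\<^sub>S\<^sub>P\<close> is \<^typ>\<open>bool\<close> with its library order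
  \<^prop>\<open>False \<le> True\<close>.\<close>

datatype pemp = PEmpty | PZero | POne | PStar

instantiation pemp :: order
begin

definition less_eq_pemp :: "pemp \<Rightarrow> pemp \<Rightarrow> bool" where
  "x \<le> y \<longleftrightarrow> x = y \<or> x = PEmpty \<or> y = PStar"

definition less_pemp :: "pemp \<Rightarrow> pemp \<Rightarrow> bool" where
  "x < y \<longleftrightarrow> x \<le> y \<and> x \<noteq> (y :: pemp)"

instance
  by standard (auto simp: less_eq_pemp_def less_pemp_def)

end

definition csp_signature :: "'r signature \<Rightarrow> ('r \<times> nat) signature" where
  "csp_signature \<sigma> = concat (map (\<lambda>(R, k). [((R, 0), k), ((R, 1), k)]) \<sigma>)"


section \<open>Polynomial-time computability\<close>

datatype letter = Zero | One | Hash

type_synonym word = "letter list"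

text \<open>Deterministic multi-tape Turing machines. States and tape symbols are natural numbers below
  the given bounds, the start state is \<open>0\<close>, the blank is \<open>0\<close>, and the machine halts when the
  transition function returns \<^const>\<open>None\<close>.\<close>

datatype move = MoveL | MoveR | Stay

record tm =
  tapes :: nat
  states :: nat
  symbols :: nat
  delta :: "nat \<Rightarrow> nat list \<Rightarrow> (nat \<times> (nat \<times> move) list) option"

fun symbol_of :: "letter \<Rightarrow> nat" where
  "symbol_of Zero = 1"
| "symbol_of One = 2"
| "symbol_of Hash = 3"

definition wf_tm :: "tm \<Rightarrow> bool" where
  "wf_tm M \<longleftrightarrow> tapes M > 0 \<and> states M > 0 \<and> symbols M \<ge> 4 \<and>
     (\<forall>q as q' acts. q < states M \<and> length as = tapes M \<and> (\<forall>a \<in> set as. a < symbols M) \<and>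
        delta M q as = Some (q', acts) \<longrightarrow>
        q' < states M \<and> length acts = tapes M \<and> (\<forall>(a, d) \<in> set acts. a < symbols M))"

text \<open>\<open>Tape l r\<close> is the two-way infinite tape with \<open>rev l\<close> immediately to the left of the head,
  \<open>r\<close> starting at the head, and blanks everywhere else.\<close>

datatype tape = Tape "nat list" "nat list"

fun read_tape :: "tape \<Rightarrow> nat" where
  "read_tape (Tape l []) = 0"
| "read_tape (Tape l (a # r)) = a"

fun write_tape :: "nat \<Rightarrow> tape \<Rightarrow> tape" where
  "write_tape a (Tape l r) = Tape l (a # tl r)"

fun move_tape :: "move \<Rightarrow> tape \<Rightarrow> tape" where
  "move_tape Stay t = t"
| "move_tape MoveL (Tape [] r) = Tape [] (0 # r)"
| "move_tape MoveL (Tape (a # l) r) = Tape l (a # r)"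
| "move_tape MoveR (Tape l []) = Tape (0 # l) []"
| "move_tape MoveR (Tape l (a # r)) = Tape (a # l) r"

type_synonym config = "nat \<times> tape list"

fun halted :: "tm \<Rightarrow> config \<Rightarrow> bool" where
  "halted M (q, ts) \<longleftrightarrow> delta M q (map read_tape ts) = None"

fun step :: "tm \<Rightarrow> config \<Rightarrow> config" where
  "step M (q, ts) =
     (case delta M q (map read_tape ts) of
        None \<Rightarrow> (q, ts)
      | Some (q', acts) \<Rightarrow> (q', map2 (\<lambda>(a, d) t. move_tape d (write_tape a t)) acts ts))"

definition init_config :: "tm \<Rightarrow> word \<Rightarrow> config" where
  "init_config M w =
     (0, Tape [] (map symbol_of w) # replicate (tapes M - 1) (Tape [] []))"

fun tape_contains :: "tape \<Rightarrow> word \<Rightarrow> bool" where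
  "tape_contains (Tape l r) w \<longleftrightarrow>
     (\<exists>i j. rev l @ r = replicate i 0 @ map symbol_of w @ replicate j 0)"

text \<open>The input is on the first tape, the output on the last one.\<close>

definition computes_within :: "tm \<Rightarrow> word \<Rightarrow> word \<Rightarrow> nat \<Rightarrow> bool" where
  "computes_within M w v T \<longleftrightarrow>
     (\<exists>n \<le> T. let c = (step M ^^ n) (init_config M w)
              in halted M c \<and> tape_contains (last (snd c)) v)"

definition polytime_on :: "word set \<Rightarrow> (word \<Rightarrow> word) \<Rightarrow> bool" where
  "polytime_on I f \<longleftrightarrow>
     (\<exists>M (p :: nat poly). wf_tm M \<and>
        (\<forall>w \<in> I. computes_within M w (f w) (poly p (length w))))"


section \<open>Decision problems and families of decision problems\<close>

record problem =
  instances :: "word set"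
  yes_instances :: "word set"

definition poly_reduces :: "problem \<Rightarrow> problem \<Rightarrow> bool" where
  "poly_reduces A B \<longleftrightarrow>
     (\<exists>f. polytime_on (instances A) f \<and>
        (\<forall>w \<in> instances A. f w \<in> instances B \<and>
           (w \<in> yes_instances A \<longleftrightarrow> f w \<in> yes_instances B)))"

definition poly_equiv :: "problem \<Rightarrow> problem \<Rightarrow> bool" where
  "poly_equiv A B \<longleftrightarrow> poly_reduces A B \<and> poly_reduces B A"

text \<open>Finding a problem of a family in polynomial time requires finite descriptions of problems,
  so a family consists of pairs of a description and the problem it describes.\<close>

type_synonym family = "(word \<times> problem) set"

definition family_reduces :: "family \<Rightarrow> family \<Rightarrow> bool" where
  "family_reduces C C' \<longleftrightarrow>
     (\<exists>F. polytime_on (fst ` C) F \<and>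
        (\<forall>(d, A) \<in> C. \<exists>A'. (F d, A') \<in> C' \<and> poly_equiv A A'))"

definition family_poly_equiv :: "family \<Rightarrow> family \<Rightarrow> bool" where
  "family_poly_equiv C C' \<longleftrightarrow> family_reduces C C' \<and> family_reduces C' C"


section \<open>Encoding of structures and homomorphism problems\<close>

text \<open>A structure is encoded by the size of its domain in unary, followed by the complete value
  table of each relation symbol. Domains are finite sets of natural numbers, enumerated in
  increasing order; the encoding thus forgets the names of the elements, and two structures have
  the same encoding only if they are isomorphic. The argument \<open>code\<close> encodes the poset values and
  has to be an injection into words over \<open>{Zero, One}\<close> of a fixed length.\<close>

definition encode_struct :: "('p \<Rightarrow> word) \<Rightarrow> 'r signature \<Rightarrow> (nat, 'r, 'p) struct \<Rightarrow> word" where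
  "encode_struct code \<sigma> G =
     (let xs = sorted_list_of_set (domain G) in
      replicate (length xs) One @ [Hash] @
      concat (map (\<lambda>(R, k).
        concat (map (\<lambda>t. code (interp G R t)) (List.n_lists k xs)) @ [Hash]) \<sigma>))"

definition hom_problem :: "('p::order \<Rightarrow> word) \<Rightarrow> 'r signature \<Rightarrow> (nat, 'r, 'p) struct \<Rightarrow> problem" where
  "hom_problem code \<sigma> H =
     \<lparr> instances = {encode_struct code \<sigma> G | G :: (nat, 'r, 'p) struct. is_struct G},
       yes_instances = {encode_struct code \<sigma> G | G :: (nat, 'r, 'p) struct.
                          is_struct G \<and> hom_exists \<sigma> G H} \<rparr>"

definition hom_family :: "('p::order \<Rightarrow> word) \<Rightarrow> 'r signature \<Rightarrow> family" where
  "hom_family code \<sigma> =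
     {(encode_struct code \<sigma> H, hom_problem code \<sigma> H) | H :: (nat, 'r, 'p) struct. is_struct H}"

fun pemp_code :: "pemp \<Rightarrow> word" where
  "pemp_code PEmpty = [Zero, Zero]"
| "pemp_code PZero = [One, Zero]"
| "pemp_code POne = [Zero, One]"
| "pemp_code PStar = [One, One]"

fun bool_code :: "bool \<Rightarrow> word" where
  "bool_code False = [Zero]"
| "bool_code True = [One]"

definition MP_family :: "'r signature \<Rightarrow> family" where
  "MP_family = hom_family pemp_code"

definition CSP_family :: "'r signature \<Rightarrow> family" where
  "CSP_family = hom_family bool_code"

end

theory Submission imports Defs begin

text \<open>A value \<open>x\<close> of \<open>P\<^sub>\<emptyset>\<close> is determined by the two bits \<open>0 \<le> x\<close> and \<open>1 \<le> x\<close>, and the order is the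
  product order on these bits. Splitting every relation into its two bits is therefore an
  equivalence between \<open>\<emptyset>\<close>-structures and relational structures which preserves and reflects
  homomorphisms. \<^const>\<open>pemp_code\<close> writes the two bits next to each other, so on encodings the
  equivalence deinterleaves every value table; a two-tape machine performs this and its inverse in
  linear time.\<close>

section \<open>Splitting and joining relations\<close>

definition split_struct :: "('a, 'r, pemp) struct \<Rightarrow> ('a, 'r \<times> nat, bool) struct" where
  "split_struct G = \<lparr> domain = domain G,
     interp = (\<lambda>(R, i) t. if i = 0 then PZero \<le> interp G R t else POne \<le> interp G R t) \<rparr>"

definition join_bits :: "bool \<Rightarrow> bool \<Rightarrow> pemp" where
  "join_bits a b = (if a then if b then PStar else PZero else if b then POne else PEmpty)"

definition join_struct :: "('a, 'r \<times> nat, bool) struct \<Rightarrow> ('a, 'r, pemp) struct" where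
  "join_struct G = \<lparr> domain = domain G,
     interp = (\<lambda>R t. join_bits (interp G (R, 0) t) (interp G (R, 1) t)) \<rparr>"

lemma domain_split_struct [simp]: "domain (split_struct G) = domain G"
  by (simp add: split_struct_def)

lemma is_struct_split_struct [simp]: "is_struct (split_struct G) \<longleftrightarrow> is_struct G"
  by (simp add: is_struct_def)

lemma is_struct_join_struct [simp]: "is_struct (join_struct G) \<longleftrightarrow> is_struct G"
  by (simp add: is_struct_def join_struct_def)

lemma zero_le_join_bits [simp]: "PZero \<le> join_bits a b \<longleftrightarrow> a"
  by (simp add: join_bits_def less_eq_pemp_def)

lemma one_le_join_bits [simp]: "POne \<le> join_bits a b \<longleftrightarrow> b"
  by (simp add: join_bits_def less_eq_pemp_def)

text \<open>A finite check over sixteen pairs. It lets one homomorphism condition over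
  \<open>pemp\<close> fall apart into two boolean ones.\<close>

lemma le_pemp_iff: "x \<le> y \<longleftrightarrow> (PZero \<le> x \<longrightarrow> PZero \<le> y) \<and> (POne \<le> x \<longrightarrow> POne \<le> y)"
  by (cases x; cases y) (simp_all add: less_eq_pemp_def)

lemma set_csp_signature:
  "set (csp_signature \<sigma>) = (\<lambda>(R, k). ((R, 0), k)) ` set \<sigma> \<union> (\<lambda>(R, k). ((R, 1), k)) ` set \<sigma>"
  by (auto simp: csp_signature_def)

text \<open>Membership in \<open>csp_signature\<close> forces the index to be 0 or 1. It matters
  because \<open>split_struct\<close> treats every nonzero index like 1, so the round trip may
  change the interpretation of other pairs.\<close>

lemma interp_split_join_struct:
  assumes "(Ri, k) \<in> set (csp_signature \<sigma>)"
  shows "interp (split_struct (join_struct G)) Ri = interp G Ri"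
  using assms by (auto simp: set_csp_signature split_struct_def join_struct_def)

lemma is_hom_split_struct:
  "is_hom (csp_signature \<sigma>) h (split_struct G) (split_struct H) \<longleftrightarrow> is_hom \<sigma> h G H"
proof -
  have "is_hom \<sigma> h G H \<longleftrightarrow> h ` domain G \<subseteq> domain H \<and>
      (\<forall>Rk \<in> set \<sigma>. \<forall>t. length t = snd Rk \<and> set t \<subseteq> domain G \<longrightarrow>
        (PZero \<le> interp G (fst Rk) t \<longrightarrow> PZero \<le> interp H (fst Rk) (map h t)) \<and>
        (POne \<le> interp G (fst Rk) t \<longrightarrow> POne \<le> interp H (fst Rk) (map h t)))"
    \<comment> \<open>Fixing the left argument to the form \<open>interp G _ _\<close> makes the
      unfolding terminate: the new inequalities have \<open>PZero\<close> or \<open>POne\<close> on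
      the left, which the general rule would rewrite again.\<close>
    unfolding is_hom_def case_prod_unfold le_pemp_iff[of "interp G _ _"] ..
  moreover have "is_hom (csp_signature \<sigma>) h (split_struct G) (split_struct H) \<longleftrightarrow>
      h ` domain G \<subseteq> domain H \<and>
      (\<forall>Rk \<in> set \<sigma>. \<forall>t. length t = snd Rk \<and> set t \<subseteq> domain G \<longrightarrow>
        (PZero \<le> interp G (fst Rk) t \<longrightarrow> PZero \<le> interp H (fst Rk) (map h t))) \<and>
      (\<forall>Rk \<in> set \<sigma>. \<forall>t. length t = snd Rk \<and> set t \<subseteq> domain G \<longrightarrow>
        (POne \<le> interp G (fst Rk) t \<longrightarrow> POne \<le> interp H (fst Rk) (map h t)))"
    by (simp add: is_hom_def set_csp_signature ball_Un split_struct_def le_bool_def case_prod_unfold)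
  ultimately show ?thesis by blast
qed

lemma hom_exists_split_struct:
  "hom_exists (csp_signature \<sigma>) (split_struct G) (split_struct H) \<longleftrightarrow> hom_exists \<sigma> G H"
  by (simp add: hom_exists_def is_hom_split_struct)

text \<open>Lets \<open>split_struct (join_struct G)\<close> replace \<open>G\<close> in
  homomorphism questions, although the two may differ on symbols outside the signature.\<close>

lemma is_hom_cong:
  assumes "domain G = domain G'" "domain H = domain H'"
    and "\<And>R k. (R, k) \<in> set \<sigma> \<Longrightarrow> interp G R = interp G' R \<and> interp H R = interp H' R"
  shows "is_hom \<sigma> h G H \<longleftrightarrow> is_hom \<sigma> h G' H'"
  unfolding is_hom_def using assms by (fastforce split: prod.splits)

lemma domain_join_struct [simp]: "domain (join_struct G) = domain G"
  by (simp add: join_struct_def)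

lemma hom_exists_split_join_struct:
  "hom_exists (csp_signature \<sigma>) (split_struct (join_struct G)) H \<longleftrightarrow> hom_exists (csp_signature \<sigma>) G H"
  "hom_exists (csp_signature \<sigma>) G (split_struct (join_struct H)) \<longleftrightarrow> hom_exists (csp_signature \<sigma>) G H"
  unfolding hom_exists_def
  by (rule ex_cong1, rule is_hom_cong, simp_all add: interp_split_join_struct)+


section \<open>Encodings of split structures\<close>

text \<open>One inner list per relation symbol, one pair of bits per tuple.
  \<open>interleaved\<close> and \<open>separated\<close> are two layouts of the same data, so the
  machines can be analysed without mentioning structures.\<close>

definition interleaved :: "(letter \<times> letter) list list \<Rightarrow> word" where
  "interleaved bs = concat (map (\<lambda>ps. concat (map (\<lambda>(a, b). [a, b]) ps) @ [Hash]) bs)"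

definition separated :: "(letter \<times> letter) list list \<Rightarrow> word" where
  "separated bs = concat (map (\<lambda>ps. map fst ps @ Hash # map snd ps @ [Hash]) bs)"

abbreviation hash_free :: "(letter \<times> letter) list \<Rightarrow> bool" where
  "hash_free ps \<equiv> \<forall>(a, b) \<in> set ps. a \<noteq> Hash \<and> b \<noteq> Hash"

lemma interleaved_simps [simp]:
  "interleaved [] = []"
  "interleaved (ps # bs) = concat (map (\<lambda>(a, b). [a, b]) ps) @ Hash # interleaved bs"
  by (simp_all add: interleaved_def)

lemma separated_simps [simp]:
  "separated [] = []"
  "separated (ps # bs) = map fst ps @ Hash # map snd ps @ Hash # separated bs"
  by (simp_all add: separated_def)

section \<open>Unique readability of the two layouts\<close>

lemma append_Cons_eq_append_ConsD:
  assumes "u @ h # x = v @ h # y" "h \<notin> set u" "h \<notin> set v"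
  shows "u = v \<and> x = y"
  using assms
proof (induction u arbitrary: v)
  case Nil
  then show ?case by (cases v) auto
next
  case (Cons a u)
  then show ?case by (cases v) auto
qed

lemma append_Cons_eq_append_Cons_iff:
  assumes "h \<notin> set u" "h \<notin> set v"
  shows "u @ h # x = v @ h # y \<longleftrightarrow> u = v \<and> x = y"
  using append_Cons_eq_append_ConsD[OF _ assms] by auto

lemma concat_pairs_inject:
  "concat (map (\<lambda>(a, b). [a, b]) ps) = concat (map (\<lambda>(a, b). [a, b]) qs) \<longleftrightarrow> ps = qs"
proof (induction ps arbitrary: qs)
  case Nil
  then show ?case by (cases qs) auto
next
  case (Cons p ps)
  show ?case
  proof (cases qs)
    case (Cons q rs)
    then show ?thesis using Cons.IH[of rs] by (cases p; cases q) simp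
  qed (cases p; simp)
qed

text \<open>The first \<open>Hash\<close> marks the end of the first block, since blocks contain
  none; inside a block every pair takes exactly two letters.\<close>

lemma interleaved_inject:
  assumes "\<forall>ps \<in> set bs. hash_free ps" "\<forall>ps \<in> set cs. hash_free ps"
  shows "interleaved bs = interleaved cs \<longleftrightarrow> bs = cs"
  using assms
proof (induction bs arbitrary: cs)
  case Nil
  then show ?case by (cases cs) auto
next
  case (Cons ps bs)
  have *: "Hash \<notin> set (concat (map (\<lambda>(a, b). [a, b]) qs))" if "hash_free qs" for qs
    using that by (induction qs) auto
  show ?case
  proof (cases cs)
    case (Cons qs ds)
    have "interleaved (ps # bs) = interleaved (qs # ds) \<longleftrightarrow>
        concat (map (\<lambda>(a, b). [a, b]) ps) = concat (map (\<lambda>(a, b). [a, b]) qs) \<and>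
        interleaved bs = interleaved ds"
      unfolding interleaved_simps
      by (rule append_Cons_eq_append_Cons_iff; rule *)
        (use Cons.prems \<open>cs = qs # ds\<close> in simp_all)
    then show ?thesis
      using Cons.prems Cons.IH[of ds] \<open>cs = qs # ds\<close> by (simp add: concat_pairs_inject)
  qed simp
qed

text \<open>The first two occurrences of \<open>Hash\<close> delimit the first and the second
  components of the first block, and these two lists determine the list of pairs.\<close>

lemma separated_inject:
  assumes "\<forall>ps \<in> set bs. hash_free ps" "\<forall>ps \<in> set cs. hash_free ps"
  shows "separated bs = separated cs \<longleftrightarrow> bs = cs"
  using assms
proof (induction bs arbitrary: cs)
  case Nil
  then show ?case by (cases cs) auto
next
  case (Cons ps bs)
  have *: "Hash \<notin> set (map fst qs)" "Hash \<notin> set (map snd qs)" if "hash_free qs" for qs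
    using that by auto
  show ?case
  proof (cases cs)
    case (Cons qs ds)
    have "separated (ps # bs) = separated (qs # ds) \<longleftrightarrow>
        map fst ps = map fst qs \<and> map snd ps = map snd qs \<and> separated bs = separated ds"
      using Cons.prems \<open>cs = qs # ds\<close> *[of ps] *[of qs]
      by (simp add: append_Cons_eq_append_Cons_iff del: set_map)
    also have "\<dots> \<longleftrightarrow> ps = qs \<and> bs = ds"
      using Cons.prems Cons.IH[of ds] \<open>cs = qs # ds\<close> by (auto intro: pair_list_eqI)
    finally show ?thesis using \<open>cs = qs # ds\<close> by simp
  qed simp
qed

section \<open>Value tables as blocks of bit pairs\<close>

definition bit_table :: "(nat, 'r, pemp) struct \<Rightarrow> 'r \<times> nat \<Rightarrow> (letter \<times> letter) list" where
  "bit_table G = (\<lambda>(R, k). map (\<lambda>t. (hd (pemp_code (interp G R t)), last (pemp_code (interp G R t))))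
     (List.n_lists k (sorted_list_of_set (domain G))))"

lemma hash_free_bit_table: "hash_free (bit_table G Rk)"
proof -
  have "hd (pemp_code x) \<noteq> Hash \<and> last (pemp_code x) \<noteq> Hash" for x
    by (cases x) simp_all
  then show ?thesis by (auto simp: bit_table_def)
qed

lemma hash_free_bit_tables: "\<forall>ps \<in> set (map (bit_table G) \<sigma>). hash_free ps"
  unfolding set_map using hash_free_bit_table by blast

lemma encode_struct_interleaved:
  "encode_struct pemp_code \<sigma> G =
     replicate (card (domain G)) One @ Hash # interleaved (map (bit_table G) \<sigma>)"
proof -
  have "pemp_code x = [hd (pemp_code x), last (pemp_code x)]" for x
    by (cases x) simp_all
  then have "concat (map (\<lambda>t. pemp_code (interp G R t)) ts) =
      concat (map (\<lambda>(a, b). [a, b])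
        (map (\<lambda>t. (hd (pemp_code (interp G R t)), last (pemp_code (interp G R t)))) ts))" for R ts
    by (simp add: comp_def)
  then show ?thesis
    by (simp add: encode_struct_def Let_def interleaved_def bit_table_def comp_def case_prod_unfold)
qed

text \<open>\<open>csp_signature\<close> lists \<open>(R, 0)\<close> directly before
  \<open>(R, 1)\<close>, so their tables are adjacent, and both enumerate the tuples in the order
  used for \<open>R\<close>. The letters of \<open>pemp_code x\<close> are the bits
  \<open>PZero \<le> x\<close> and \<open>POne \<le> x\<close>.\<close>

lemma encode_struct_separated:
  "encode_struct bool_code (csp_signature \<sigma>) (split_struct G) =
     replicate (card (domain G)) One @ Hash # separated (map (bit_table G) \<sigma>)"
proof -
  have code: "bool_code (PZero \<le> x) = [hd (pemp_code x)]" "bool_code (POne \<le> x) = [last (pemp_code x)]"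
    for x by (cases x; simp add: less_eq_pemp_def)+
  show ?thesis
    by (induction \<sigma>) (auto simp: encode_struct_def Let_def bit_table_def csp_signature_def
        split_struct_def code comp_def)
qed

text \<open>Both equations say that the domain sizes and the bit tables agree. This makes the
  translations between encodings well defined, although an encoding forgets the names of the
  elements.\<close>

lemma encode_split_struct_eq_iff:
  "encode_struct bool_code (csp_signature \<sigma>) (split_struct G) =
     encode_struct bool_code (csp_signature \<sigma>) (split_struct G') \<longleftrightarrow>
   encode_struct pemp_code \<sigma> G = encode_struct pemp_code \<sigma> G'"
  by (simp add: encode_struct_interleaved encode_struct_separated append_Cons_eq_append_Cons_iff
      separated_inject interleaved_inject hash_free_bit_tables del: set_map)

text \<open>The encoding reads only symbols of the signature, where the round trip is the identity.
  Hence every relational encoding is that of a split structure.\<close>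

lemma encode_split_join_struct:
  "encode_struct bool_code (csp_signature \<sigma>) (split_struct (join_struct G)) =
   encode_struct bool_code (csp_signature \<sigma>) G"
proof -
  have "domain (join_struct G) = domain G" by (simp add: join_struct_def)
  then show ?thesis
    unfolding encode_struct_def Let_def
    by (auto simp: interp_split_join_struct intro!: arg_cong[where f = concat])
qed


section \<open>Linear-time machines\<close>

definition reaches :: "tm \<Rightarrow> nat \<Rightarrow> config \<Rightarrow> config \<Rightarrow> bool" where
  "reaches M t c c' \<longleftrightarrow> (\<exists>n \<le> t. (step M ^^ n) c = c')"

lemma reaches_refl: "reaches M t c c"
  unfolding reaches_def by (rule exI[of _ 0]) simp

lemma reaches_step: "reaches M t (step M c) c' \<Longrightarrow> reaches M (Suc t) c c'"
  unfolding reaches_def by (metis Suc_le_mono comp_apply funpow_Suc_right)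

lemma reaches_trans:
  assumes "reaches M s c c'" "reaches M t c' c''"
  shows "reaches M (s + t) c c''"
proof -
  obtain m n where "m \<le> s" "(step M ^^ m) c = c'" "n \<le> t" "(step M ^^ n) c' = c''"
    using assms by (auto simp: reaches_def)
  then have "n + m \<le> s + t" "(step M ^^ (n + m)) c = c''"
    by (simp_all add: funpow_add)
  then show ?thesis unfolding reaches_def by blast
qed

lemma reaches_mono: "reaches M s c c' \<Longrightarrow> s \<le> t \<Longrightarrow> reaches M t c c'"
  unfolding reaches_def by (blast intro: order_trans)

text \<open>Both machines stop with the output head just behind the last output letter, so the whole
  output lies, reversed, in the left part of the tape.\<close>

lemma computes_withinI:
  assumes "reaches M T (init_config M w) (q, ts)" "halted M (q, ts)"
    "last ts = Tape (rev (map symbol_of v)) []"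
  shows "computes_within M w v T"
proof -
  have "tape_contains (last ts) v"
    using assms(3) by (auto intro!: exI[of _ 0])
  then show ?thesis
    using assms(1,2) by (auto simp: computes_within_def reaches_def Let_def)
qed

lemma symbol_of_eq [simp]:
  "symbol_of a \<noteq> 0" "0 < symbol_of a" "symbol_of a = 3 \<longleftrightarrow> a = Hash" "symbol_of a = Suc 0 \<longleftrightarrow> a = Zero"
  by (cases a; simp)+

text \<open>Both machines copy the unary domain size in state 0 and start every block in state 1.
  The deinterleaving machine copies the first bits of a block (states 1, 2), goes back on the input
  to the preceding \<^const>\<open>Hash\<close> (state 3) and copies the second bits (states 4, 5).\<close>

fun split_delta :: "nat \<Rightarrow> nat list \<Rightarrow> (nat \<times> (nat \<times> move) list) option" where
  "split_delta q [a, b] =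
     (if a = 0 then None else Some (
      if q = 0 then (if a = 3 then 1 else 0, [(a, MoveR), (a, MoveR)])
      else if q = 1 then if a = 3 then (3, [(a, MoveL), (a, MoveR)]) else (2, [(a, MoveR), (a, MoveR)])
      else if q = 2 then (1, [(a, MoveR), (b, Stay)])
      else if q = 3 then if a = 3 then (4, [(a, MoveR), (b, Stay)]) else (3, [(a, MoveL), (b, Stay)])
      else if q = 4 then if a = 3 then (1, [(a, MoveR), (a, MoveR)]) else (5, [(a, MoveR), (b, Stay)])
      else (4, [(a, MoveR), (a, MoveR)])))"
| "split_delta q _ = None"

text \<open>The interleaving machine writes the first bits, each followed by the placeholder
  \<^const>\<open>Zero\<close> (states 1, 2), goes back on the output to the preceding \<^const>\<open>Hash\<close>
  (state 3) and overwrites the placeholders with the second bits (states 4, 5).\<close>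

fun join_delta :: "nat \<Rightarrow> nat list \<Rightarrow> (nat \<times> (nat \<times> move) list) option" where
  "join_delta q [a, b] =
     (if a = 0 then None else Some (
      if q = 0 then (if a = 3 then 1 else 0, [(a, MoveR), (a, MoveR)])
      else if q = 1 then if a = 3 then (3, [(a, MoveR), (b, MoveL)]) else (2, [(a, Stay), (a, MoveR)])
      else if q = 2 then (1, [(a, MoveR), (1, MoveR)])
      else if q = 3 then if b = 3 then (4, [(a, Stay), (b, MoveR)]) else (3, [(a, Stay), (b, MoveL)])
      else if q = 4 then if a = 3 then (1, [(a, MoveR), (a, MoveR)]) else (5, [(a, Stay), (b, MoveR)])
      else (4, [(a, MoveR), (a, MoveR)])))"
| "join_delta q _ = None"

definition split_tm :: tm where
  "split_tm = \<lparr> tapes = 2, states = 6, symbols = 4, delta = split_delta \<rparr>"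

definition join_tm :: tm where
  "join_tm = \<lparr> tapes = 2, states = 6, symbols = 4, delta = join_delta \<rparr>"

lemma tm_simps [simp]:
  "delta split_tm = split_delta" "delta join_tm = join_delta"
  "tapes split_tm = 2" "tapes join_tm = 2"
  by (simp_all add: split_tm_def join_tm_def)

lemma wf_split_tm: "wf_tm split_tm"
  unfolding wf_tm_def split_tm_def
  by (auto simp: length_Suc_conv numeral_2_eq_2 split: if_splits)

lemma wf_join_tm: "wf_tm join_tm"
  unfolding wf_tm_def join_tm_def
  by (auto simp: length_Suc_conv numeral_2_eq_2 split: if_splits)

text \<open>The machines agree in state 0. The run leaves \<open>3\<close>, the symbol of
  \<open>Hash\<close>, directly left of both heads; it is the marker at which the rewinding of the
  first block stops.\<close>

lemma copy_size:
  assumes "delta M = split_delta \<or> delta M = join_delta"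
  shows "reaches M (Suc n)
     (0, [Tape l (replicate n 2 @ 3 # r), Tape l' []])
     (1, [Tape (3 # replicate n 2 @ l) r, Tape (3 # replicate n 2 @ l') []])"
proof (induction n arbitrary: l l')
  case 0
  then show ?case
    using assms by (intro reaches_step) (auto intro: reaches_refl)
next
  case (Suc n)
  have "reaches M (Suc (Suc n)) (0, [Tape l (replicate (Suc n) 2 @ 3 # r), Tape l' []])
     (1, [Tape (3 # replicate n 2 @ 2 # l) r, Tape (3 # replicate n 2 @ 2 # l') []])"
    using assms Suc.IH[of "2 # l" "2 # l'"] by (intro reaches_step[of _ "Suc n"]) auto
  then show ?case by (simp add: replicate_app_Cons_same)
qed

section \<open>Correctness of the deinterleaving machine\<close>

lemma split_first_bits:
  assumes "hash_free ps" "tl out = []"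
  shows "reaches split_tm (2 * length ps + 1)
     (1, [Tape l (map symbol_of (concat (map (\<lambda>(a, b). [a, b]) ps)) @ 3 # r), Tape l' out])
     (3, [move_tape MoveL (Tape (rev (map symbol_of (concat (map (\<lambda>(a, b). [a, b]) ps))) @ l) (3 # r)),
          Tape (3 # rev (map (symbol_of \<circ> fst) ps) @ l') []])"
  using assms
proof (induction ps arbitrary: l l' out)
  case Nil
  then show ?case by (auto intro!: reaches_step reaches_refl)
next
  case (Cons p ps)
  obtain a b where p: "p = (a, b)" by (cases p)
  show ?case
    \<comment> \<open>State 2 writes back the blank it reads on the output tape, which turns the
      empty right part into \<open>[0]\<close>; this is why the claim is stated for a general
      \<open>out\<close>.\<close>
    using Cons.prems Cons.IH[of "[0]" "symbol_of b # symbol_of a # l" "symbol_of a # l'"]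
    by (simp add: p) (rule reaches_step, simp, rule reaches_step, simp)
qed

text \<open>The \<open>MoveL\<close> is left unevaluated so that empty and nonempty
  \<open>us\<close> have the same form. No blank in \<open>us\<close> keeps the machine from
  halting, no \<open>3\<close> keeps it from turning round early.\<close>

lemma split_rewind:
  assumes "0 \<notin> set us" "3 \<notin> set us" "tl out = []" "out = [] \<or> hd out = 0"
  shows "reaches split_tm (length us + 1)
     (3, [move_tape MoveL (Tape (us @ 3 # l) r), Tape l' out])
     (4, [Tape (3 # l) (rev us @ r), Tape l' [0]])"
  using assms
proof (induction us arbitrary: r out)
  case Nil
  then show ?case by (cases out) (auto intro!: reaches_step reaches_refl)
next
  case (Cons u us)
  show ?case
    using Cons.prems Cons.IH[of "[0]" "u # r"]
    by (cases out) (simp, rule reaches_step, simp)+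
qed

lemma split_second_bits:
  assumes "hash_free ps" "tl out = []"
  shows "reaches split_tm (2 * length ps + 1)
     (4, [Tape l (map symbol_of (concat (map (\<lambda>(a, b). [a, b]) ps)) @ 3 # r), Tape l' out])
     (1, [Tape (3 # rev (map symbol_of (concat (map (\<lambda>(a, b). [a, b]) ps))) @ l) r,
          Tape (3 # rev (map (symbol_of \<circ> snd) ps) @ l') []])"
  using assms
proof (induction ps arbitrary: l l' out)
  case Nil
  then show ?case by (auto intro!: reaches_step reaches_refl)
next
  case (Cons p ps)
  obtain a b where p: "p = (a, b)" by (cases p)
  show ?case
    using Cons.prems Cons.IH[of "[]" "symbol_of b # symbol_of a # l" "symbol_of b # l'"]
    by (simp add: p) (rule reaches_step, simp, rule reaches_step, simp)
qed

lemma length_concat_pairs [simp]: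
  "length (concat (map (\<lambda>(a, b). [a, b]) ps)) = 2 * length ps"
  by (induction ps) auto

lemma symbols_hash_free:
  assumes "hash_free ps"
  shows "0 \<notin> set (rev (map symbol_of (concat (map (\<lambda>(a, b). [a, b]) ps))))"
    "3 \<notin> set (rev (map symbol_of (concat (map (\<lambda>(a, b). [a, b]) ps))))"
  using assms by (induction ps) (auto simp: image_iff)

text \<open>Three passes over the block, each of \<open>2 * length ps + 1\<close> steps. The
  \<open>3\<close> left of the input head is the marker for the rewind, and the final configuration
  provides it again for the next block.\<close>

lemma split_block:
  assumes "hash_free ps"
  shows "reaches split_tm (6 * length ps + 3)
     (1, [Tape (3 # l) (map symbol_of (concat (map (\<lambda>(a, b). [a, b]) ps)) @ 3 # r), Tape l' []])
     (1, [Tape (3 # rev (map symbol_of (concat (map (\<lambda>(a, b). [a, b]) ps))) @ 3 # l) r,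
          Tape (3 # rev (map (symbol_of \<circ> snd) ps) @ 3 # rev (map (symbol_of \<circ> fst) ps) @ l') []])"
proof -
  let ?us = "map symbol_of (concat (map (\<lambda>(a, b). [a, b]) ps))"
  let ?l' = "3 # rev (map (symbol_of \<circ> fst) ps) @ l'"
  have "reaches split_tm (2 * length ps + 1)
      (1, [Tape (3 # l) (?us @ 3 # r), Tape l' []])
      (3, [move_tape MoveL (Tape (rev ?us @ 3 # l) (3 # r)), Tape ?l' []])"
    by (rule split_first_bits) (use assms in auto)
  moreover have "reaches split_tm (2 * length ps + 1)
      (3, [move_tape MoveL (Tape (rev ?us @ 3 # l) (3 # r)), Tape ?l' []])
      (4, [Tape (3 # l) (?us @ 3 # r), Tape ?l' [0]])"
    using split_rewind[OF symbols_hash_free[OF assms], of "[]" l "3 # r" ?l']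
    by (simp only: rev_rev_ident length_rev length_map length_concat_pairs) simp
  moreover have "reaches split_tm (2 * length ps + 1)
      (4, [Tape (3 # l) (?us @ 3 # r), Tape ?l' [0]])
      (1, [Tape (3 # rev ?us @ 3 # l) r, Tape (3 # rev (map (symbol_of \<circ> snd) ps) @ ?l') []])"
    by (rule split_second_bits) (use assms in auto)
  ultimately have "reaches split_tm ((2 * length ps + 1) + (2 * length ps + 1) + (2 * length ps + 1))
      (1, [Tape (3 # l) (?us @ 3 # r), Tape l' []])
      (1, [Tape (3 # rev ?us @ 3 # l) r, Tape (3 # rev (map (symbol_of \<circ> snd) ps) @ ?l') []])"
    by (blast intro: reaches_trans)
  moreover have "(2 * length ps + 1) + (2 * length ps + 1) + (2 * length ps + 1) = 6 * length ps + 3"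
    by simp
  ultimately show ?thesis by (simp only: append_Cons)
qed

text \<open>A block of \<open>2 * length ps + 1\<close> letters costs exactly three times its
  length. What remains on the input tape is irrelevant, hence the existential
  \<open>l''\<close>.\<close>

lemma split_blocks:
  assumes "\<forall>ps \<in> set bs. hash_free ps"
  shows "\<exists>l''. reaches split_tm (3 * length (interleaved bs))
     (1, [Tape (3 # l) (map symbol_of (interleaved bs)), Tape l' []])
     (1, [Tape l'' [], Tape (rev (map symbol_of (separated bs)) @ l') []])"
  using assms
proof (induction bs arbitrary: l l')
  case Nil
  then show ?case by (auto intro: reaches_refl)
next
  case (Cons ps bs)
  let ?us = "map symbol_of (concat (map (\<lambda>(a, b). [a, b]) ps))"
  let ?l' = "3 # rev (map (symbol_of \<circ> snd) ps) @ 3 # rev (map (symbol_of \<circ> fst) ps) @ l'"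
  obtain l'' where "reaches split_tm (3 * length (interleaved bs))
      (1, [Tape (3 # rev ?us @ 3 # l) (map symbol_of (interleaved bs)), Tape ?l' []])
      (1, [Tape l'' [], Tape (rev (map symbol_of (separated bs)) @ ?l') []])"
    using Cons.IH Cons.prems by (metis list.set_intros(2))
  then have "reaches split_tm (6 * length ps + 3 + 3 * length (interleaved bs))
      (1, [Tape (3 # l) (?us @ 3 # map symbol_of (interleaved bs)), Tape l' []])
      (1, [Tape l'' [], Tape (rev (map symbol_of (separated bs)) @ ?l') []])"
    using Cons.prems by (intro reaches_trans[OF split_block]) auto
  then show ?case
    by (auto intro!: exI[of _ l''] elim!: reaches_mono)
qed

lemma split_tm_computes:
  fixes n :: nat
  assumes "\<forall>ps \<in> set bs. hash_free ps"
  defines "w \<equiv> replicate n One @ Hash # interleaved bs"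
  shows "computes_within split_tm w (replicate n One @ Hash # separated bs) (3 * length w)"
proof -
  let ?l = "3 # replicate n 2"
  obtain l'' where "reaches split_tm (3 * length (interleaved bs))
      (1, [Tape ?l (map symbol_of (interleaved bs)), Tape ?l []])
      (1, [Tape l'' [], Tape (rev (map symbol_of (separated bs)) @ ?l) []])"
    using split_blocks[OF assms(1)] by blast
  with copy_size[of split_tm n "[]" "map symbol_of (interleaved bs)" "[]"]
  have "reaches split_tm (Suc n + 3 * length (interleaved bs)) (init_config split_tm w)
      (1, [Tape l'' [], Tape (rev (map symbol_of (separated bs)) @ ?l) []])"
    by (intro reaches_trans) (auto simp: init_config_def w_def)
  then have "reaches split_tm (3 * length w) (init_config split_tm w)
      (1, [Tape l'' [], Tape (rev (map symbol_of (separated bs)) @ ?l) []])"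
    by (rule reaches_mono) (simp add: w_def)
  \<comment> \<open>The input head has passed the end of the word and reads the blank, on which
    \<open>split_delta\<close> is undefined, so the machine has halted.\<close>
  then show ?thesis
    by (rule computes_withinI) simp_all
qed

section \<open>Correctness of the interleaving machine\<close>

lemma join_first_bits:
  assumes "\<forall>a \<in> set us. a \<noteq> Hash"
  shows "reaches join_tm (2 * length us + 1)
     (1, [Tape l (map symbol_of us @ 3 # r), Tape l' []])
     (3, [Tape (3 # rev (map symbol_of us) @ l) r,
          move_tape MoveL (Tape (rev (concat (map (\<lambda>a. [symbol_of a, 1]) us)) @ l') [0])])"
  using assms
proof (induction us arbitrary: l l')
  case Nil
  then show ?case by (auto intro!: reaches_step reaches_refl)
next
  case (Cons a us)
  show ?case
    using Cons.prems Cons.IH[of "symbol_of a # l" "1 # symbol_of a # l'"]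
    by simp (rule reaches_step, simp, rule reaches_step, simp)
qed

text \<open>Here the output head moves back while the input head stands still. The machine halts on
  a blank input symbol only, so \<open>c \<noteq> 0\<close> is what keeps it running.\<close>

lemma join_rewind:
  assumes "3 \<notin> set us" "c \<noteq> 0"
  shows "reaches join_tm (length us + 1)
     (3, [Tape l (c # r), move_tape MoveL (Tape (us @ 3 # l') out)])
     (4, [Tape l (c # r), Tape (3 # l') (rev us @ out)])"
  using assms
proof (induction us arbitrary: out)
  case Nil
  then show ?case by (auto intro!: reaches_step reaches_refl)
next
  case (Cons u us)
  show ?case
    using Cons.prems Cons.IH[of "u # out"] by simp (rule reaches_step, simp)
qed

text \<open>Each second bit overwrites the placeholder \<open>1\<close> after its first bit. The
  trailing \<open>[0]\<close> is the blank written when the rewind began; the closing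
  \<open>Hash\<close> overwrites it.\<close>

lemma join_second_bits:
  assumes "hash_free ps"
  shows "reaches join_tm (2 * length ps + 1)
     (4, [Tape l (map (symbol_of \<circ> snd) ps @ 3 # r),
          Tape l' (concat (map (\<lambda>a. [symbol_of a, 1]) (map fst ps)) @ [0])])
     (1, [Tape (3 # rev (map (symbol_of \<circ> snd) ps) @ l) r,
          Tape (3 # rev (map symbol_of (concat (map (\<lambda>(a, b). [a, b]) ps))) @ l') []])"
  using assms
proof (induction ps arbitrary: l l')
  case Nil
  then show ?case by (auto intro!: reaches_step reaches_refl)
next
  case (Cons p ps)
  obtain a b where p: "p = (a, b)" by (cases p)
  show ?case
    using Cons.prems Cons.IH[of "symbol_of b # l" "symbol_of b # symbol_of a # l'"]
    by (simp add: p) (rule reaches_step, simp, rule reaches_step, simp)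
qed

lemma join_block:
  assumes "hash_free ps"
  shows "reaches join_tm (6 * length ps + 3)
     (1, [Tape l (map (symbol_of \<circ> fst) ps @ 3 # map (symbol_of \<circ> snd) ps @ 3 # r), Tape (3 # l') []])
     (1, [Tape (3 # rev (map (symbol_of \<circ> snd) ps) @ 3 # rev (map (symbol_of \<circ> fst) ps) @ l) r,
          Tape (3 # rev (map symbol_of (concat (map (\<lambda>(a, b). [a, b]) ps))) @ 3 # l') []])"
proof -
  let ?out = "concat (map (\<lambda>a. [symbol_of a, 1]) (map fst ps))"
  let ?vs = "map (symbol_of \<circ> snd) ps @ 3 # r"
  let ?l = "3 # rev (map (symbol_of \<circ> fst) ps) @ l"
  have "reaches join_tm (2 * length ps + 1)
      (1, [Tape l (map (symbol_of \<circ> fst) ps @ 3 # ?vs), Tape (3 # l') []])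
      (3, [Tape ?l ?vs, move_tape MoveL (Tape (rev ?out @ 3 # l') [0])])"
  proof -
    have "\<forall>a \<in> set (map fst ps). a \<noteq> Hash"
      using assms by auto
    from join_first_bits[OF this, of l ?vs "3 # l'"] show ?thesis by simp
  qed
  moreover have "reaches join_tm (2 * length ps + 1)
      (3, [Tape ?l ?vs, move_tape MoveL (Tape (rev ?out @ 3 # l') [0])])
      (4, [Tape ?l ?vs, Tape (3 # l') (?out @ [0])])"
  proof -
    \<comment> \<open>During the rewind the input head is on the first of the second bits or, if the
      block is empty, on the closing \<open>Hash\<close>.\<close>
    obtain c vs where "?vs = c # vs" "c \<noteq> 0"
      by (cases ps) auto
    moreover have "3 \<notin> set (rev ?out)"
      using assms by auto
    moreover have "length ?out = 2 * length ps"
      by (induction ps) auto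
    ultimately show ?thesis
      using join_rewind[of "rev ?out" c ?l vs l' "[0]"] by simp
  qed
  moreover have "reaches join_tm (2 * length ps + 1)
      (4, [Tape ?l ?vs, Tape (3 # l') (?out @ [0])])
      (1, [Tape (3 # rev (map (symbol_of \<circ> snd) ps) @ ?l) r,
           Tape (3 # rev (map symbol_of (concat (map (\<lambda>(a, b). [a, b]) ps))) @ 3 # l') []])"
    by (rule join_second_bits) (use assms in auto)
  ultimately have "reaches join_tm ((2 * length ps + 1) + (2 * length ps + 1) + (2 * length ps + 1))
      (1, [Tape l (map (symbol_of \<circ> fst) ps @ 3 # ?vs), Tape (3 # l') []])
      (1, [Tape (3 # rev (map (symbol_of \<circ> snd) ps) @ ?l) r,
           Tape (3 # rev (map symbol_of (concat (map (\<lambda>(a, b). [a, b]) ps))) @ 3 # l') []])"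
    by (blast intro: reaches_trans)
  moreover have "(2 * length ps + 1) + (2 * length ps + 1) + (2 * length ps + 1) = 6 * length ps + 3"
    by simp
  ultimately show ?thesis by (simp only: append_Cons)
qed

text \<open>A separated block has \<open>2 * length ps + 2\<close> letters and costs
  \<open>6 * length ps + 3\<close> steps, so the factor three leaves some slack. The marker for the
  rewind is now the \<open>3\<close> on the output tape.\<close>

lemma join_blocks:
  assumes "\<forall>ps \<in> set bs. hash_free ps"
  shows "\<exists>l''. reaches join_tm (3 * length (separated bs))
     (1, [Tape l (map symbol_of (separated bs)), Tape (3 # l') []])
     (1, [Tape l'' [], Tape (rev (map symbol_of (interleaved bs)) @ 3 # l') []])"
  using assms
proof (induction bs arbitrary: l l')
  case Nil
  then show ?case by (auto intro: reaches_refl)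
next
  case (Cons ps bs)
  let ?l = "3 # rev (map (symbol_of \<circ> snd) ps) @ 3 # rev (map (symbol_of \<circ> fst) ps) @ l"
  let ?l' = "rev (map symbol_of (concat (map (\<lambda>(a, b). [a, b]) ps))) @ 3 # l'"
  obtain l'' where IH: "reaches join_tm (3 * length (separated bs))
      (1, [Tape ?l (map symbol_of (separated bs)), Tape (3 # ?l') []])
      (1, [Tape l'' [], Tape (rev (map symbol_of (interleaved bs)) @ 3 # ?l') []])"
    using Cons.IH Cons.prems by (metis list.set_intros(2))
  have "reaches join_tm (6 * length ps + 3 + 3 * length (separated bs))
      (1, [Tape l (map (symbol_of \<circ> fst) ps @ 3 # map (symbol_of \<circ> snd) ps @ 3 #
             map symbol_of (separated bs)), Tape (3 # l') []])
      (1, [Tape l'' [], Tape (rev (map symbol_of (interleaved bs)) @ 3 # ?l') []])"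
    using Cons.prems by (intro reaches_trans[OF join_block IH]) auto
  then show ?case
    by (auto intro!: exI[of _ l''] elim!: reaches_mono)
qed

lemma join_tm_computes:
  fixes n :: nat
  assumes "\<forall>ps \<in> set bs. hash_free ps"
  defines "w \<equiv> replicate n One @ Hash # separated bs"
  shows "computes_within join_tm w (replicate n One @ Hash # interleaved bs) (3 * length w)"
proof -
  let ?l = "3 # replicate n 2"
  obtain l'' where "reaches join_tm (3 * length (separated bs))
      (1, [Tape ?l (map symbol_of (separated bs)), Tape ?l []])
      (1, [Tape l'' [], Tape (rev (map symbol_of (interleaved bs)) @ ?l) []])"
    using join_blocks[OF assms(1)] by blast
  with copy_size[of join_tm n "[]" "map symbol_of (separated bs)" "[]"]
  have "reaches join_tm (Suc n + 3 * length (separated bs)) (init_config join_tm w)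
      (1, [Tape l'' [], Tape (rev (map symbol_of (interleaved bs)) @ ?l) []])"
    by (intro reaches_trans) (auto simp: init_config_def w_def)
  then have "reaches join_tm (3 * length w) (init_config join_tm w)
      (1, [Tape l'' [], Tape (rev (map symbol_of (interleaved bs)) @ ?l) []])"
    by (rule reaches_mono) (simp add: w_def)
  then show ?thesis
    by (rule computes_withinI) simp_all
qed


section \<open>Equivalence of the families\<close>

definition split_word :: "'r signature \<Rightarrow> word \<Rightarrow> word" where
  "split_word \<sigma> w = encode_struct bool_code (csp_signature \<sigma>)
     (split_struct (SOME G. is_struct G \<and> encode_struct pemp_code \<sigma> G = w))"

definition join_word :: "'r signature \<Rightarrow> word \<Rightarrow> word" where
  "join_word \<sigma> w = encode_struct pemp_code \<sigma>
     (SOME G. is_struct G \<and> encode_struct bool_code (csp_signature \<sigma>) (split_struct G) = w)"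

text \<open>The choice made by \<open>SOME\<close> has no influence: structures with equal encodings
  have equal encodings after splitting. On words that encode nothing the value is arbitrary, and no
  reduction constrains it there.\<close>

lemma split_word_encode [simp]:
  assumes "is_struct G"
  shows "split_word \<sigma> (encode_struct pemp_code \<sigma> G) =
    encode_struct bool_code (csp_signature \<sigma>) (split_struct G)"
  unfolding split_word_def
  by (rule someI2[where a = G]) (use assms in \<open>simp_all add: encode_split_struct_eq_iff\<close>)

lemma join_word_encode [simp]:
  assumes "is_struct G"
  shows "join_word \<sigma> (encode_struct bool_code (csp_signature \<sigma>) (split_struct G)) =
    encode_struct pemp_code \<sigma> G"
  unfolding join_word_def
  by (rule someI2[where a = G]) (use assms in \<open>simp_all add: encode_split_struct_eq_iff\<close>)

lemma polytime_on_linearI: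
  assumes "wf_tm M" "\<And>w. w \<in> I \<Longrightarrow> computes_within M w (f w) (c * length w)"
  shows "polytime_on I f"
  unfolding polytime_on_def
  using assms by (intro exI[of _ M] exI[of _ "[:0, c:]"]) (simp add: mult.commute)

lemma polytime_split_word:
  "polytime_on {encode_struct pemp_code \<sigma> G | G. is_struct G} (split_word \<sigma>)"
proof (rule polytime_on_linearI[OF wf_split_tm])
  fix w assume "w \<in> {encode_struct pemp_code \<sigma> G | G. is_struct G}"
  then obtain G where G: "is_struct G" "w = encode_struct pemp_code \<sigma> G" by blast
  show "computes_within split_tm w (split_word \<sigma> w) (3 * length w)"
    using split_tm_computes[OF hash_free_bit_tables, of "card (domain G)" G \<sigma>] G
    \<comment> \<open>Two rounds are needed: unfolding \<open>encode_struct_interleaved\<close> at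
      once would destroy the argument that \<open>split_word_encode\<close> has to match.\<close>
    by (simp add: encode_struct_separated) (simp add: encode_struct_interleaved)
qed

lemma polytime_join_word:
  "polytime_on {encode_struct bool_code (csp_signature \<sigma>) (split_struct G) | G. is_struct G}
     (join_word \<sigma>)"
proof (rule polytime_on_linearI[OF wf_join_tm])
  fix w assume "w \<in> {encode_struct bool_code (csp_signature \<sigma>) (split_struct G) | G. is_struct G}"
  then obtain G where G: "is_struct G"
      "w = encode_struct bool_code (csp_signature \<sigma>) (split_struct G)" by blast
  show "computes_within join_tm w (join_word \<sigma> w) (3 * length w)"
    using join_tm_computes[OF hash_free_bit_tables, of "card (domain G)" G \<sigma>] G
    by (simp add: encode_struct_interleaved) (simp add: encode_struct_separated)
qed

text \<open>\<open>split_struct (join_struct G)\<close> has the same encoding as \<open>G\<close>,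
  so a property invariant under this round trip may be restricted to split structures. It serves for
  all instances and for the yes-instances.\<close>

lemma csp_encodings_split:
  assumes "\<And>G. P (split_struct (join_struct G)) \<longleftrightarrow> P G"
  shows "{encode_struct bool_code (csp_signature \<sigma>) G | G. is_struct G \<and> P G} =
    {encode_struct bool_code (csp_signature \<sigma>) (split_struct G) | G. is_struct G \<and> P (split_struct G)}"
proof (intro equalityI subsetI)
  fix w assume "w \<in> {encode_struct bool_code (csp_signature \<sigma>) G | G. is_struct G \<and> P G}"
  then obtain G where "is_struct (join_struct G)" "P (split_struct (join_struct G))"
      "w = encode_struct bool_code (csp_signature \<sigma>) (split_struct (join_struct G))"
    using assms by (auto simp: encode_split_join_struct)
  then show "w \<in> {encode_struct bool_code (csp_signature \<sigma>) (split_struct G) | G.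
      is_struct G \<and> P (split_struct G)}" by blast
next
  fix w assume "w \<in> {encode_struct bool_code (csp_signature \<sigma>) (split_struct G) | G.
      is_struct G \<and> P (split_struct G)}"
  then obtain G where "is_struct (split_struct G)" "P (split_struct G)"
      "w = encode_struct bool_code (csp_signature \<sigma>) (split_struct G)"
    by auto
  then show "w \<in> {encode_struct bool_code (csp_signature \<sigma>) G | G. is_struct G \<and> P G}" by blast
qed

lemma instances_CSP:
  "instances (hom_problem bool_code (csp_signature \<sigma>) H) =
    {encode_struct bool_code (csp_signature \<sigma>) (split_struct G) | G. is_struct G}"
  using csp_encodings_split[of "\<lambda>_. True"] by (simp add: hom_problem_def)

lemma yes_instances_CSP:
  "yes_instances (hom_problem bool_code (csp_signature \<sigma>) (split_struct H)) =
    {encode_struct bool_code (csp_signature \<sigma>) (split_struct G) | G. is_struct G \<and> hom_exists \<sigma> G H}"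
  using csp_encodings_split[of "\<lambda>G. hom_exists (csp_signature \<sigma>) G (split_struct H)" \<sigma>,
      OF hom_exists_split_join_struct(1)]
  by (simp add: hom_problem_def hom_exists_split_struct)

lemma poly_equiv_split_struct:
  "poly_equiv (hom_problem pemp_code \<sigma> H)
     (hom_problem bool_code (csp_signature \<sigma>) (split_struct H))"
proof -
  let ?A = "hom_problem pemp_code \<sigma> H"
  let ?B = "hom_problem bool_code (csp_signature \<sigma>) (split_struct H)"
  \<comment> \<open>A word is a yes-instance if some structure with that encoding maps to the
    template; \<open>encode_split_struct_eq_iff\<close> shows that the structures competing on both
    sides are the same.\<close>
  have yes: "encode_struct pemp_code \<sigma> G \<in> yes_instances ?A \<longleftrightarrow>
      encode_struct bool_code (csp_signature \<sigma>) (split_struct G) \<in> yes_instances ?B" for G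
    unfolding yes_instances_CSP by (simp add: hom_problem_def encode_split_struct_eq_iff)
  have inst: "instances ?A = {encode_struct pemp_code \<sigma> G | G. is_struct G}"
    by (simp add: hom_problem_def)
  have "poly_reduces ?A ?B"
    unfolding poly_reduces_def instances_CSP inst
    using polytime_split_word yes by (intro exI[of _ "split_word \<sigma>"]) auto
  moreover have "poly_reduces ?B ?A"
    unfolding poly_reduces_def instances_CSP inst
    using polytime_join_word yes by (intro exI[of _ "join_word \<sigma>"]) auto
  ultimately show ?thesis by (simp add: poly_equiv_def)
qed

lemma poly_equiv_sym: "poly_equiv A B \<Longrightarrow> poly_equiv B A"
  by (simp add: poly_equiv_def)

theorem mainTheorem1:
  fixes \<sigma> :: "'r signature"
  assumes "is_signature \<sigma>"
  shows "family_poly_equiv (MP_family \<sigma>) (CSP_family (csp_signature \<sigma>))"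
proof -
  have MP: "fst ` MP_family \<sigma> = {encode_struct pemp_code \<sigma> G | G. is_struct G}"
    by (auto simp: MP_family_def hom_family_def image_iff)
  \<comment> \<open>Replacing a template \<open>H\<close> by
    \<open>split_struct (join_struct H)\<close> changes neither its description nor its problem, so
    split templates exhaust the family.\<close>
  have CSP: "CSP_family (csp_signature \<sigma>) =
      {(encode_struct bool_code (csp_signature \<sigma>) (split_struct H),
        hom_problem bool_code (csp_signature \<sigma>) (split_struct H)) | H. is_struct H}" (is "_ = ?C")
  proof (intro equalityI subsetI)
    fix x assume "x \<in> CSP_family (csp_signature \<sigma>)"
    then obtain H where H: "is_struct H" "x = (encode_struct bool_code (csp_signature \<sigma>) H,
        hom_problem bool_code (csp_signature \<sigma>) H)"
      by (auto simp: CSP_family_def hom_family_def)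
    then have "x = (encode_struct bool_code (csp_signature \<sigma>) (split_struct (join_struct H)),
        hom_problem bool_code (csp_signature \<sigma>) (split_struct (join_struct H)))"
      by (simp add: encode_split_join_struct hom_problem_def hom_exists_split_join_struct)
    then show "x \<in> ?C" using H(1) by (intro CollectI exI[of _ "join_struct H"]) simp
  qed (auto simp: CSP_family_def hom_family_def)
  then have CSP': "fst ` CSP_family (csp_signature \<sigma>) =
      {encode_struct bool_code (csp_signature \<sigma>) (split_struct G) | G. is_struct G}"
    by (auto simp: image_iff)
  \<comment> \<open>Problems are described by the encodings of their templates, so the word map that
    translates instances also finds the partner problem.\<close>
  have "family_reduces (MP_family \<sigma>) (CSP_family (csp_signature \<sigma>))"
    unfolding family_reduces_def MP
  proof (intro exI[of _ "split_word \<sigma>"] conjI polytime_split_word ballI)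
    fix x assume "x \<in> MP_family \<sigma>"
    then obtain H where H: "is_struct H"
        "x = (encode_struct pemp_code \<sigma> H, hom_problem pemp_code \<sigma> H)"
      by (auto simp: MP_family_def hom_family_def)
    then have "(split_word \<sigma> (fst x), hom_problem bool_code (csp_signature \<sigma>) (split_struct H))
        \<in> CSP_family (csp_signature \<sigma>)"
      unfolding CSP by auto
    then show "case x of (d, A) \<Rightarrow>
        \<exists>A'. (split_word \<sigma> d, A') \<in> CSP_family (csp_signature \<sigma>) \<and> poly_equiv A A'"
      using H(2) poly_equiv_split_struct by auto
  qed
  moreover have "family_reduces (CSP_family (csp_signature \<sigma>)) (MP_family \<sigma>)"
    unfolding family_reduces_def CSP'
  proof (intro exI[of _ "join_word \<sigma>"] conjI polytime_join_word ballI)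
    fix x assume "x \<in> CSP_family (csp_signature \<sigma>)"
    then obtain H where H: "is_struct H"
        "x = (encode_struct bool_code (csp_signature \<sigma>) (split_struct H),
          hom_problem bool_code (csp_signature \<sigma>) (split_struct H))"
      unfolding CSP by blast
    then have "(join_word \<sigma> (fst x), hom_problem pemp_code \<sigma> H) \<in> MP_family \<sigma>"
      by (auto simp: MP_family_def hom_family_def)
    then show "case x of (d, A) \<Rightarrow>
        \<exists>A'. (join_word \<sigma> d, A') \<in> MP_family \<sigma> \<and> poly_equiv A A'"
      using H(2) poly_equiv_sym[OF poly_equiv_split_struct] by auto
  qed
  ultimately show ?thesis by (simp add: family_poly_equiv_def)
qed

end
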